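(* Let $k,w,s\in\mathbb Z_{>0}$ and $g\in\{0,1,\ldots,s\}$. For $k=1$, \[ \bigl(\delta_{1,g}^{(w,s)}\bigr)'=(g^w), \] where zero parts are omitted. For $k\ge2$, \[ \bigl(\delta_{k,g}^{(w,s)}\bigr)' =\bigl((s(k-1)+g)^w,(s(k-2)+g)^w,\ldots,(s+g)^w,g^w\bigr), \] again with zero parts omitted. In particular, \[ \bigl(\delta_{k,0}^{(w,s)}\bigr)'=\delta_k^{(s,w)}, \quad \bigl(\delta_{k,s}^{(w,s)}\bigr)'=\delta_{k+1}^{(s,w)}. \] For $0<g<s$, the conjugate partition $\bigl(\delta_{k,g}^{(w,s)}\bigr)'$ is not equal to $\delta_{k,h}^{(s,w)}$ for any $h\in\{0,1,\ldots,w\}$. For $0\le g<s$, conjugation sends the horizontal strip $\delta_{k,g+1}^{(w,s)}/\delta_{k,g}^{(w,s)}$ to a vertical strip of size $wk$ (namely $(\delta_{k,g+1}^{(w,s)})'/(\delta_{k,g}^{(w,s)})'$). Moreover, every successive difference in the sequence $\bigl((\delta_{k,g}^{(w,s)})'\bigr)_{g=0}^{s}$ is a vertical strip, and this sequence is the unique shortest sequence of partitions between the conjugate endpoints $\delta_k^{(s,w)}$ and $\delta_{k+1}^{(s,w)}$ with the property that every successive difference is a vertical strip.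
   Context: A partition is a weakly decreasing sequence of nonnegative integers with finitely many nonzero parts, identified with its Young diagram $\{(i,j)\in\mathbb Z_{>0}^2:1\le j\le\lambda_i\}$ (rows indexed from top to bottom). The conjugate $\lambda'$ is given by $\lambda'_j=|\{i:\lambda_i\ge j\}|$. Exponents on parts denote multiplicities; a part with multiplicity $0$ is omitted. Generalized staircase partitions: for $w,s\in\mathbb Z_{>0}$, $\delta_1^{(w,s)}=\varnothing$ and, for $k\ge2$, $\delta_k^{(w,s)}=\bigl((w(k-1))^s,(w(k-2))^s,\ldots,w^s\bigr)$. Intermediate generalized staircase partitions: for $0\le g\le s$, $\delta_{1,g}^{(w,s)}=(w^g)$ (with $\delta_{1,0}^{(w,s)}=\varnothing$) and, for $k\ge2$, $\delta_{k,g}^{(w,s)}=\bigl((wk)^g,(w(k-1))^s,(w(k-2))^s,\ldots,w^s\bigr)$. The notation $\delta_{k,h}^{(s,w)}$, $0\le h\le w$, is the same with the roles of $w$ and $s$ interchanged. For $\mu\subseteq\lambda$, the skew diagram $\lambda/\mu$ is the set difference of Young diagrams; it is a horizontal (resp. vertical) strip if it contains at most one box in each column (resp. row). A sequence of partitions from $\alpha$ to $\beta$ with $m$ steps whose successive differences are vertical strips is $\alpha=\lambda^{(0)}\subseteq\cdots\subseteq\lambda^{(m)}=\beta$ with every $\lambda^{(i)}/\lambda^{(i-1)}$ a vertical strip; shortest means with the minimum number $m$ of steps. *)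

theory Defs
  imports Main "HOL-Library.More_List"
begin

text \<open>
  A partition is its infinite sequence of parts, so trailing zeros carry no information.
  Rows and columns are counted from \<open>0\<close>: \<open>p i\<close> is the part usually written \<open>\<lambda>\<^sub>i\<^sub>+\<^sub>1\<close>.
\<close>

type_synonym parts = "nat \<Rightarrow> nat"

definition is_partition :: "parts \<Rightarrow> bool" where
  "is_partition p \<longleftrightarrow> antimono p \<and> finite {i. p i \<noteq> 0}"

text \<open>Zero entries at the end of \<open>xs\<close> are omitted automatically.\<close>

abbreviation parts_of :: "nat list \<Rightarrow> parts" where
  "parts_of xs \<equiv> nth_default 0 xs"

definition young :: "parts \<Rightarrow> (nat \<times> nat) set" where
  "young p = {(i, j). j < p i}"

text \<open>In \<open>0\<close>-based indexing, \<open>j < p i\<close> says that the \<open>i\<close>-th part is at least \<open>j + 1\<close>.\<close>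

definition conjugate :: "parts \<Rightarrow> parts" where
  "conjugate p j = card {i. j < p i}"

definition skew :: "parts \<Rightarrow> parts \<Rightarrow> (nat \<times> nat) set" where
  "skew p q = young p - young q"

definition horizontal_strip :: "(nat \<times> nat) set \<Rightarrow> bool" where
  "horizontal_strip S \<longleftrightarrow> (\<forall>i i' j. (i, j) \<in> S \<longrightarrow> (i', j) \<in> S \<longrightarrow> i = i')"

definition vertical_strip :: "(nat \<times> nat) set \<Rightarrow> bool" where
  "vertical_strip S \<longleftrightarrow> (\<forall>i j j'. (i, j) \<in> S \<longrightarrow> (i, j') \<in> S \<longrightarrow> j = j')"

text \<open>
  The parts \<open>(w(k-1))\<^sup>s, (w(k-2))\<^sup>s, \<dots>, w\<^sup>s\<close>; this list is empty for \<open>k = 1\<close>.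
  Only \<open>k \<ge> 1\<close> is meaningful.
\<close>

definition staircase_list :: "nat \<Rightarrow> nat \<Rightarrow> nat \<Rightarrow> nat list" where
  "staircase_list w s k = concat (map (\<lambda>j. replicate s (w * j)) (rev [1..<k]))"

text \<open>\<open>\<delta>\<^sub>k\<close> with superscript \<open>(w, s)\<close>\<close>

definition staircase :: "nat \<Rightarrow> nat \<Rightarrow> nat \<Rightarrow> parts" where
  "staircase w s k = parts_of (staircase_list w s k)"

text \<open>\<open>\<delta>\<close> with subscript \<open>k, g\<close> and superscript \<open>(w, s)\<close>\<close>

definition inter_staircase :: "nat \<Rightarrow> nat \<Rightarrow> nat \<Rightarrow> nat \<Rightarrow> parts" where
  "inter_staircase w s k g = parts_of (replicate g (w * k) @ staircase_list w s k)"

text \<open>Sequences with \<open>m\<close> steps are lists of \<open>m + 1\<close> partitions.\<close>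

definition vertical_strip_seq :: "parts \<Rightarrow> parts \<Rightarrow> nat \<Rightarrow> parts list \<Rightarrow> bool" where
  "vertical_strip_seq a b m L \<longleftrightarrow>
     length L = Suc m \<and> L ! 0 = a \<and> L ! m = b \<and> (\<forall>p \<in> set L. is_partition p) \<and>
     (\<forall>i < m. young (L ! i) \<subseteq> young (L ! Suc i) \<and> vertical_strip (skew (L ! Suc i) (L ! i)))"

definition shortest_vertical_strip_seq :: "parts \<Rightarrow> parts \<Rightarrow> parts list \<Rightarrow> bool" where
  "shortest_vertical_strip_seq a b L \<longleftrightarrow>
     (\<exists>m. vertical_strip_seq a b m L \<and> (\<forall>m' L'. vertical_strip_seq a b m' L' \<longrightarrow> m \<le> m'))"

end

theory Submission
  imports Defs
begin

text \<open>
  With rows and columns counted from \<open>0\<close>, a box \<open>(i, j)\<close> lies in the intermediate staircase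
  exactly when \<open>j < w * k\<close> and \<open>i < s * (k - 1 - j div w) + g\<close>. The second bound is therefore the
  height of column \<open>j\<close>, that is, row \<open>j\<close> of the conjugate (\<open>conjugate_inter_staircase\<close>). In this
  form \<open>g\<close> is a height added uniformly to the first \<open>w * k\<close> rows of the conjugate: \<open>g = 0\<close> and
  \<open>g = s\<close> give the two neighbouring staircases with \<open>w\<close> and \<open>s\<close> interchanged, and raising \<open>g\<close>
  by one adds one box to each of these rows, which is a vertical strip of size \<open>w * k\<close>. For
  \<open>0 < g < s\<close> the last nonzero row has length \<open>g\<close>, which is not a multiple of \<open>s\<close>, whereas all parts
  of an intermediate staircase of type \<open>(s, w)\<close> are multiples of \<open>s\<close>.

  Minimality and uniqueness hold because a vertical strip lengthens every row by at most one, while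
  the two endpoints differ by exactly \<open>s\<close> in each of the first \<open>w * k\<close> rows and agree elsewhere.
  Hence at least \<open>s\<close> steps are needed, and with \<open>s\<close> steps each of these rows must grow by exactly
  one in every step (\<open>shortest_vertical_strip_seq_uniform_iff\<close>).
\<close>

section \<open>Conjugation and strips\<close>

text \<open>
  The rows longer than \<open>j\<close> form a finite initial segment of the natural numbers, so counting them
  is the same as naming the first row that fails to be longer.
\<close>

lemma less_conjugate_iff:
  assumes "is_partition p"
  shows "i < conjugate p j \<longleftrightarrow> j < p i"
proof -
  let ?S = "{i. j < p i}"
  have fin: "finite ?S"
    using assms by (auto simp: is_partition_def elim!: rev_finite_subset)
  have down: "i' \<in> ?S" if "i \<in> ?S" "i' \<le> i" for i i'
    using that assms by (auto simp: is_partition_def dest: antimonoD order_less_le_trans)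
  show ?thesis
  proof
    assume "j < p i"
    then have "{..i} \<subseteq> ?S" using down by auto
    from card_mono[OF fin this] show "i < conjugate p j" by (simp add: conjugate_def)
  next
    assume lt: "i < conjugate p j"
    show "j < p i"
    proof (rule ccontr)
      assume "\<not> j < p i"
      then have "?S \<subseteq> {..<i}" using down by (metis linorder_not_less mem_Collect_eq lessThan_iff subsetI)
      from card_mono[OF _ this] lt show False by (simp add: conjugate_def)
    qed
  qed
qed

lemma conjugate_eqI:
  assumes "\<And>i. j < p i \<longleftrightarrow> i < c"
  shows "conjugate p j = c"
  using assms by (simp add: conjugate_def lessThan_def[symmetric])

lemma is_partition_conjugate:
  assumes "is_partition p"
  shows "is_partition (conjugate p)"
proof -
  have "antimono (conjugate p)"
  proof (rule antimonoI)
    fix j j' :: nat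
    assume "j \<le> j'"
    then have "i < conjugate p j" if "i < conjugate p j'" for i
      using that by (simp add: less_conjugate_iff[OF assms])
    then show "conjugate p j' \<le> conjugate p j" by (meson linorder_not_less order_less_irrefl)
  qed
  moreover have "{j. conjugate p j \<noteq> 0} \<subseteq> {..<p 0}"
    using less_conjugate_iff[OF assms] by auto
  ultimately show ?thesis
    by (auto simp: is_partition_def intro: finite_subset)
qed

lemma young_conjugate:
  assumes "is_partition p"
  shows "young (conjugate p) = prod.swap ` young p"
  by (auto simp: young_def less_conjugate_iff[OF assms] image_iff)

lemma skew_conjugate:
  assumes "is_partition p" "is_partition q"
  shows "skew (conjugate q) (conjugate p) = prod.swap ` skew q p"
  by (simp add: skew_def young_conjugate assms image_set_diff)

lemma vertical_strip_swap_iff: "vertical_strip (prod.swap ` S) \<longleftrightarrow> horizontal_strip S"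
  by (force simp: vertical_strip_def horizontal_strip_def image_iff)

lemma young_subset_iff: "young p \<subseteq> young q \<longleftrightarrow> (\<forall>i. p i \<le> q i)"
proof -
  have "young p \<subseteq> young q \<longleftrightarrow> (\<forall>i j. j < p i \<longrightarrow> j < q i)"
    by (auto simp: young_def)
  then show ?thesis by (meson linorder_not_less order_less_irrefl order_less_le_trans)
qed

text \<open>Row \<open>i\<close> of the difference consists of the columns \<open>j\<close> with \<open>p i \<le> j < q i\<close>.\<close>

lemma vertical_strip_skew_iff: "vertical_strip (skew q p) \<longleftrightarrow> (\<forall>i. q i \<le> Suc (p i))"
proof
  assume strip: "vertical_strip (skew q p)"
  show "\<forall>i. q i \<le> Suc (p i)"
  proof (rule allI, rule ccontr)
    fix i
    assume "\<not> q i \<le> Suc (p i)"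
    then have "(i, p i) \<in> skew q p" "(i, Suc (p i)) \<in> skew q p"
      by (auto simp: skew_def young_def)
    with strip show False unfolding vertical_strip_def by (metis n_not_Suc_n)
  qed
next
  assume "\<forall>i. q i \<le> Suc (p i)"
  then show "vertical_strip (skew q p)"
    unfolding vertical_strip_def skew_def young_def
    by (auto, metis less_Suc_eq_le order.antisym order_less_le_trans linorder_not_less)
qed

section \<open>Shortest sequences between uniformly shifted partitions\<close>

lemma vertical_strip_seq_le:
  assumes "vertical_strip_seq a b m L" "t \<le> u" "u \<le> m"
  shows "(L ! t) i \<le> (L ! u) i" "(L ! u) i \<le> (L ! t) i + (u - t)"
proof -
  have grow: "(L ! v) i \<le> (L ! Suc v) i \<and> (L ! Suc v) i \<le> Suc ((L ! v) i)" if "v < m" for v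
    using that assms(1) by (simp add: vertical_strip_seq_def young_subset_iff vertical_strip_skew_iff)
  have "(L ! t) i \<le> (L ! u) i \<and> (L ! u) i \<le> (L ! t) i + (u - t)"
    using assms(2,3)
  proof (induction u rule: dec_induct)
    case (step v)
    then show ?case using grow[of v] by auto
  qed simp
  then show "(L ! t) i \<le> (L ! u) i" "(L ! u) i \<le> (L ! t) i + (u - t)" by auto
qed

text \<open>
  If \<open>b\<close> arises from \<open>a\<close> by lengthening a nonempty set \<open>A\<close> of rows by \<open>s\<close>, then after \<open>t\<close> of \<open>s\<close>
  steps a row in \<open>A\<close> has grown by at most \<open>t\<close>, and in the remaining steps it grows by at most
  \<open>s - t\<close>; the two must add up to \<open>s\<close>, so it has grown by exactly \<open>t\<close>. Rows outside \<open>A\<close> cannot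
  change because the sequence is increasing. That the resulting list is a valid sequence is a
  hypothesis, since its members are partitions only for suitable \<open>a\<close> and \<open>A\<close>.
\<close>

lemma shortest_vertical_strip_seq_uniform_iff:
  fixes a b :: parts
  defines "M \<equiv> (\<lambda>s A. map (\<lambda>t i. if i \<in> A then a i + t else a i) [0..<s + 1])"
  assumes b: "\<And>i. b i = (if i \<in> A then a i + s else a i)" and "A \<noteq> {}"
    and M: "vertical_strip_seq a b s (M s A)"
  shows "shortest_vertical_strip_seq a b L \<longleftrightarrow> L = M s A"
proof -
  have min: "s \<le> m" if "vertical_strip_seq a b m L'" for m L'
  proof -
    obtain i where "i \<in> A" using \<open>A \<noteq> {}\<close> by blast
    then have "a i + s \<le> a i + m"
      using vertical_strip_seq_le(2)[OF that, of 0 m i] that b[of i]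
      by (simp add: vertical_strip_seq_def)
    then show ?thesis by simp
  qed
  have unique: "L' = M s A" if L': "vertical_strip_seq a b s L'" for L'
  proof (rule nth_equalityI)
    show "length L' = length (M s A)"
      using L' by (simp add: vertical_strip_seq_def M_def)
    fix t
    assume "t < length L'"
    then have t: "t \<le> s" using L' by (simp add: vertical_strip_seq_def)
    have ends: "L' ! 0 = a" "L' ! s = b" using L' by (auto simp: vertical_strip_seq_def)
    have "(L' ! t) i = (if i \<in> A then a i + t else a i)" for i
      using vertical_strip_seq_le[OF L', of 0 t i] vertical_strip_seq_le[OF L', of t s i] t ends b[of i]
      by (auto split: if_splits)
    then show "L' ! t = M s A ! t"
      using t by (auto simp: M_def fun_eq_iff simp del: upt_Suc)
  qed
  show ?thesis
  proof
    assume "shortest_vertical_strip_seq a b L"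
    then obtain m where m: "vertical_strip_seq a b m L" "\<And>m' L'. vertical_strip_seq a b m' L' \<Longrightarrow> m \<le> m'"
      by (auto simp: shortest_vertical_strip_seq_def)
    with M min have "m = s" by (meson order.antisym)
    with m unique show "L = M s A" by simp
  next
    assume "L = M s A"
    with M min show "shortest_vertical_strip_seq a b L"
      by (auto simp: shortest_vertical_strip_seq_def)
  qed
qed

section \<open>Closed forms for staircases and their conjugates\<close>

lemma nth_default_descending_blocks:
  assumes "w > 0"
  shows "parts_of (concat (map (\<lambda>j. replicate w (f j)) (rev [1..<Suc n])) @ ys) i =
    (if i < w * n then f (n - i div w) else parts_of ys (i - w * n))"
proof (induction n arbitrary: i)
  case (Suc n)
  show ?case
  proof (cases "i < w")
    case True
    then show ?thesis by (simp add: nth_default_append nth_default_nth)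
  next
    case False
    then have "i div w = Suc ((i - w) div w)" using assms by (simp add: le_div_geq)
    moreover have "parts_of (concat (map (\<lambda>j. replicate w (f j)) (rev [1..<Suc (Suc n)])) @ ys) i =
      parts_of (concat (map (\<lambda>j. replicate w (f j)) (rev [1..<Suc n])) @ ys) (i - w)"
      using False by (simp add: nth_default_append)
    ultimately show ?thesis using Suc.IH[of "i - w"] False by auto
  qed
qed simp

text \<open>
  Truncated subtraction makes the bound vanish from row \<open>s * (k - 1)\<close> on, so the end of the list
  of parts needs no case distinction.
\<close>

lemma staircase_nth:
  assumes "s > 0" "k > 0"
  shows "staircase w s k i = w * (k - 1 - i div s)"
proof -
  obtain n where "k = Suc n" using \<open>k > 0\<close> gr0_conv_Suc by blast
  moreover have "n - i div s = 0" if "\<not> i < s * n"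
    using that assms(1) by (simp add: less_eq_div_iff_mult_less_eq mult.commute)
  ultimately show ?thesis
    using nth_default_descending_blocks[OF assms(1), of "\<lambda>j. w * j" n "[]" i]
    by (simp add: staircase_def staircase_list_def del: upt_Suc)
qed

lemma inter_staircase_nth:
  assumes "s > 0" "k > 0"
  shows "inter_staircase w s k g i = (if i < g then w * k else w * (k - 1 - (i - g) div s))"
  using staircase_nth[OF assms, of w "i - g"]
  by (simp add: inter_staircase_def staircase_def nth_default_append nth_default_nth)

lemma is_partition_inter_staircase:
  assumes "s > 0" "k > 0"
  shows "is_partition (inter_staircase w s k g)"
proof -
  have "antimono (inter_staircase w s k g)"
    by (rule antimonoI)
      (auto simp: inter_staircase_nth[OF assms] intro!: diff_le_mono2 div_le_mono diff_le_mono)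
  moreover have "{i. inter_staircase w s k g i \<noteq> 0} \<subseteq> {..<length (replicate g (w * k) @ staircase_list w s k)}"
    unfolding inter_staircase_def by (auto simp: nth_default_def simp del: length_append)
  ultimately show ?thesis by (auto simp: is_partition_def intro: finite_subset)
qed

text \<open>
  Column \<open>j\<close> contains the \<open>g\<close> rows of length \<open>w * k\<close> at the top whenever \<open>j < w * k\<close>. A later row
  \<open>i\<close> reaches it when \<open>j div w + (i - g) div s < k - 1\<close>; this is symmetric in the two quotients,
  so it can be solved for \<open>i\<close> just as it was for \<open>j\<close>.
\<close>

lemma conjugate_inter_staircase:
  assumes "w > 0" "s > 0" "k > 0"
  shows "conjugate (inter_staircase w s k g) j =
    (if j < w * k then s * (k - 1 - j div w) + g else 0)"
proof (rule conjugate_eqI)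
  fix i
  have below: "j < w * m \<longleftrightarrow> j div w < m" for m
    using \<open>w > 0\<close> by (simp add: div_less_iff_less_mult mult.commute)
  have "(i - g) div s < m \<longleftrightarrow> i - g < s * m" for m
    using \<open>s > 0\<close> by (simp add: div_less_iff_less_mult mult.commute)
  \<comment> \<open>exchanging the roles of rows and columns\<close>
  moreover have "j div w < k - 1 - (i - g) div s \<longleftrightarrow> (i - g) div s < k - 1 - j div w"
    by auto
  ultimately have
    "j < w * (k - 1 - (i - g) div s) \<longleftrightarrow> i - g < s * (k - 1 - j div w)"
    by (simp only: below)
  moreover have "j div w < k" if "i - g < s * (k - 1 - j div w)"
    using that by (cases "k - 1 - j div w") auto
  ultimately show "j < inter_staircase w s k g i \<longleftrightarrow>
      i < (if j < w * k then s * (k - 1 - j div w) + g else 0)"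
    using assms by (auto simp: inter_staircase_nth below)
qed

lemma conjugate_inter_staircase_eq_parts_of:
  assumes "w > 0" "s > 0" "k > 0"
  shows "conjugate (inter_staircase w s k g) =
    parts_of (concat (map (\<lambda>j. replicate w (s * j + g)) (rev [1..<k])) @ replicate w g)"
proof
  fix j
  obtain n where k: "k = Suc n" using \<open>k > 0\<close> gr0_conv_Suc by blast
  have below: "j < w * m \<longleftrightarrow> j div w < m" for m
    using \<open>w > 0\<close> by (simp add: div_less_iff_less_mult mult.commute)
  have "parts_of (replicate w g) (j - w * n) = (if j < w * Suc n then g else 0)" if "\<not> j < w * n"
    using that by (auto simp: nth_default_def)
  then show "conjugate (inter_staircase w s k g) j =
      parts_of (concat (map (\<lambda>j. replicate w (s * j + g)) (rev [1..<k])) @ replicate w g) j"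
    unfolding k nth_default_descending_blocks[OF \<open>w > 0\<close>] conjugate_inter_staircase[OF assms[unfolded k]]
    by (auto simp: below simp del: mult_Suc_right)
qed

lemma conjugate_inter_staircase_0:
  assumes "w > 0" "s > 0" "k > 0"
  shows "conjugate (inter_staircase w s k 0) = staircase s w k"
proof
  fix j
  have "k - 1 - j div w = 0" if "\<not> j < w * k"
    using that less_eq_div_iff_mult_less_eq[OF \<open>w > 0\<close>, of k j] by (simp add: mult.commute)
  then show "conjugate (inter_staircase w s k 0) j = staircase s w k j"
    using assms by (auto simp: conjugate_inter_staircase staircase_nth)
qed

lemma conjugate_inter_staircase_full:
  assumes "w > 0" "s > 0" "k > 0"
  shows "conjugate (inter_staircase w s k s) = staircase s w (k + 1)"
proof
  fix j
  have below: "j < w * k \<longleftrightarrow> j div w < k"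
    using \<open>w > 0\<close> by (simp add: div_less_iff_less_mult mult.commute)
  have "s * (k - 1 - j div w) + s = s * (k - j div w)" if "j div w < k"
    using that by (metis Suc_diff_Suc add.commute diff_Suc_eq_diff_pred diff_commute mult_Suc_right)
  then show "conjugate (inter_staircase w s k s) j = staircase s w (k + 1) j"
    using assms by (auto simp: conjugate_inter_staircase staircase_nth below)
qed

lemma conjugate_inter_staircase_neq:
  assumes "w > 0" "s > 0" "k > 0" "0 < g" "g < s"
  shows "conjugate (inter_staircase w s k g) \<noteq> inter_staircase s w k h"
proof
  assume eq: "conjugate (inter_staircase w s k g) = inter_staircase s w k h"
  \<comment> \<open>the top row of the lowest block, which has length \<open>g\<close>\<close>
  let ?j = "w * (k - 1)"
  have "?j < w * k" using assms by simp
  then have "conjugate (inter_staircase w s k g) ?j = g"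
    using assms by (simp add: conjugate_inter_staircase)
  moreover have "s dvd inter_staircase s w k h ?j"
    using assms by (simp add: inter_staircase_nth)
  ultimately show False using eq assms by (auto dest: dvd_imp_le)
qed

section \<open>Consecutive intermediate staircases\<close>

lemma young_inter_staircase_mono:
  assumes "w > 0" "s > 0" "k > 0"
  shows "young (inter_staircase w s k g) \<subseteq> young (inter_staircase w s k (g + 1))"
    and "young (conjugate (inter_staircase w s k g)) \<subseteq> young (conjugate (inter_staircase w s k (g + 1)))"
proof -
  show conj: "young (conjugate (inter_staircase w s k g)) \<subseteq> young (conjugate (inter_staircase w s k (g + 1)))"
    using assms by (simp add: young_subset_iff conjugate_inter_staircase)
  then show "young (inter_staircase w s k g) \<subseteq> young (inter_staircase w s k (g + 1))"
    using assms by (simp add: young_conjugate is_partition_inter_staircase inj_image_subset_iff)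
qed

lemma vertical_strip_conjugate_inter_staircase:
  assumes "w > 0" "s > 0" "k > 0"
  shows "vertical_strip (skew (conjugate (inter_staircase w s k (g + 1))) (conjugate (inter_staircase w s k g)))"
  using assms by (simp add: vertical_strip_skew_iff conjugate_inter_staircase)

lemma card_skew_conjugate_inter_staircase:
  assumes "w > 0" "s > 0" "k > 0"
  shows "card (skew (conjugate (inter_staircase w s k (g + 1))) (conjugate (inter_staircase w s k g))) = w * k"
proof -
  have "skew (conjugate (inter_staircase w s k (g + 1))) (conjugate (inter_staircase w s k g)) =
      (\<lambda>j. (j, s * (k - 1 - j div w) + g)) ` {..<w * k}"
    using assms by (auto simp: skew_def young_def conjugate_inter_staircase image_iff split: if_splits)
  then show ?thesis by (simp add: card_image inj_on_def)
qed

lemma vertical_strip_seq_conjugate_inter_staircase: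
  assumes "w > 0" "s > 0" "k > 0"
  shows "vertical_strip_seq (staircase s w k) (staircase s w (k + 1)) s
    (map (\<lambda>t. conjugate (inter_staircase w s k t)) [0..<s + 1])"
  using young_inter_staircase_mono(2)[OF assms] vertical_strip_conjugate_inter_staircase[OF assms]
    conjugate_inter_staircase_0[OF assms] conjugate_inter_staircase_full[OF assms] assms
  by (auto simp: vertical_strip_seq_def is_partition_conjugate is_partition_inter_staircase
      simp del: upt_Suc)

lemma shortest_vertical_strip_seq_staircase_iff:
  assumes "w > 0" "s > 0" "k > 0"
  shows "shortest_vertical_strip_seq (staircase s w k) (staircase s w (k + 1)) L \<longleftrightarrow>
    L = map (\<lambda>t. conjugate (inter_staircase w s k t)) [0..<s + 1]"
proof -
  let ?a = "staircase s w k" and ?A = "{..<w * k}"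
  have shift: "conjugate (inter_staircase w s k t) = (\<lambda>i. if i \<in> ?A then ?a i + t else ?a i)" for t
    using assms by (auto simp: fun_eq_iff conjugate_inter_staircase
        simp flip: conjugate_inter_staircase_0[OF assms])
  show ?thesis
    unfolding shift
  proof (rule shortest_vertical_strip_seq_uniform_iff)
    show "staircase s w (k + 1) i = (if i \<in> ?A then ?a i + s else ?a i)" for i
      using conjugate_inter_staircase_full[OF assms] shift[of s] by metis
    show "?A \<noteq> {}" using assms by (simp add: lessThan_empty_iff)
    show "vertical_strip_seq ?a (staircase s w (k + 1)) s
        (map (\<lambda>t i. if i \<in> ?A then ?a i + t else ?a i) [0..<s + 1])"
      using vertical_strip_seq_conjugate_inter_staircase[OF assms] unfolding shift .
  qed
qed

theorem proposition3p3:
  fixes k w s g :: nat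
  assumes "k > 0" and "w > 0" and "s > 0" and "g \<le> s"
  shows "(k = 1 \<longrightarrow> conjugate (inter_staircase w s k g) = parts_of (replicate w g))
    \<and> (k \<ge> 2 \<longrightarrow> conjugate (inter_staircase w s k g) =
         parts_of (concat (map (\<lambda>j. replicate w (s * j + g)) (rev [1..<k])) @ replicate w g))
    \<and> conjugate (inter_staircase w s k 0) = staircase s w k
    \<and> conjugate (inter_staircase w s k s) = staircase s w (k + 1)
    \<and> (0 < g \<and> g < s \<longrightarrow>
         (\<forall>h \<le> w. conjugate (inter_staircase w s k g) \<noteq> inter_staircase s w k h))
    \<and> (g < s \<longrightarrow>
         (let p = inter_staircase w s k g; q = inter_staircase w s k (g + 1) in
           young p \<subseteq> young q
           \<and> horizontal_strip (skew q p)
           \<and> prod.swap ` skew q p = skew (conjugate q) (conjugate p)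
           \<and> young (conjugate p) \<subseteq> young (conjugate q)
           \<and> vertical_strip (skew (conjugate q) (conjugate p))
           \<and> card (skew (conjugate q) (conjugate p)) = w * k))
    \<and> vertical_strip_seq (staircase s w k) (staircase s w (k + 1)) s
         (map (\<lambda>t. conjugate (inter_staircase w s k t)) [0..<s + 1])
    \<and> (\<forall>L. shortest_vertical_strip_seq (staircase s w k) (staircase s w (k + 1)) L \<longleftrightarrow>
         L = map (\<lambda>t. conjugate (inter_staircase w s k t)) [0..<s + 1])"
proof -
  note pos = \<open>w > 0\<close> \<open>s > 0\<close> \<open>k > 0\<close>
  let ?p = "\<lambda>g. inter_staircase w s k g"
  have part: "is_partition (?p t)" for t
    using is_partition_inter_staircase pos by simp
  have "horizontal_strip (skew (?p (g + 1)) (?p g))"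
    using vertical_strip_conjugate_inter_staircase[OF pos]
    by (simp only: skew_conjugate[OF part part] vertical_strip_swap_iff)
  then have strips: "let p = ?p g; q = ?p (g + 1) in
      young p \<subseteq> young q
      \<and> horizontal_strip (skew q p)
      \<and> prod.swap ` skew q p = skew (conjugate q) (conjugate p)
      \<and> young (conjugate p) \<subseteq> young (conjugate q)
      \<and> vertical_strip (skew (conjugate q) (conjugate p))
      \<and> card (skew (conjugate q) (conjugate p)) = w * k"
    unfolding Let_def
    using young_inter_staircase_mono[OF pos] vertical_strip_conjugate_inter_staircase[OF pos]
      card_skew_conjugate_inter_staircase[OF pos] skew_conjugate[OF part part]
    by metis
  have one: "k = 1 \<longrightarrow> conjugate (?p g) = parts_of (replicate w g)"
    using conjugate_inter_staircase_eq_parts_of[OF pos, of g] by auto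
  show ?thesis
    using one strips conjugate_inter_staircase_eq_parts_of[OF pos] conjugate_inter_staircase_0[OF pos]
      conjugate_inter_staircase_full[OF pos] conjugate_inter_staircase_neq[OF pos]
      vertical_strip_seq_conjugate_inter_staircase[OF pos]
      shortest_vertical_strip_seq_staircase_iff[OF pos]
    by (intro conjI impI allI) blast+
qed

end
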